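(* $\displaystyle\limsup_{s\to\infty}R_2(s)\ge\frac{40}{81}$.
   Context: All invertibility is over $\mathbb{F}_2$. For an $s\times s$ invertible $0$-$1$ matrix $M$, $N_2(M)$ is the number of invertible $2\times2$ submatrices of $M$ (one for each choice of two rows and two columns), $R_2(M)=N_2(M)/\binom{s}{2}^2$, and $R_2(s)=\max\{R_2(M): M \text{ is an } s\times s \text{ invertible } 0\text{-}1 \text{ matrix}\}$. *)

theory Defs
  imports
    "HOL-Library.Z2"
    "HOL-Library.Extended_Real"
    "HOL-Library.Liminf_Limsup"
    "Jordan_Normal_Form.DL_Submatrix"
begin

text \<open>
  0-1 matrices are matrices over the two-element field \<^typ>\<open>bit\<close>, so \<^const>\<open>invertible_mat\<close> means
  invertibility over that field.
\<close>

definition inv_mats :: "nat \<Rightarrow> bit mat set" where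
  "inv_mats s = {M \<in> carrier_mat s s. invertible_mat M}"

definition N2 :: "bit mat \<Rightarrow> nat" where
  "N2 M = card {(I, J). I \<subseteq> {..<dim_row M} \<and> card I = 2 \<and>
                        J \<subseteq> {..<dim_col M} \<and> card J = 2 \<and>
                        invertible_mat (submatrix M I J)}"

text \<open>
  For matrices of size less than 2 the denominator below is zero, and so is the ratio, as division
  by zero yields zero; this does not affect the limit superior.
\<close>

definition R2_mat :: "bit mat \<Rightarrow> real" where
  "R2_mat M = real (N2 M) / (real (dim_row M choose 2))\<^sup>2"

definition R2 :: "nat \<Rightarrow> real" where
  "R2 s = Max (R2_mat ` inv_mats s)"

text \<open>The maximum is over a finite nonempty set.\<close>

lemma finite_inv_mats: "finite (inv_mats s)"
proof -
  have *: "finite (UNIV :: bit set)"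
  proof (rule finite_subset)
    show "(UNIV :: bit set) \<subseteq> {0, 1}"
      using bit.exhaust by blast
  qed simp
  let ?D = "{..<s} \<times> {..<s}"
  have "carrier_mat s s \<subseteq> (\<lambda>f. mat s s f :: bit mat) ` (PiE ?D (\<lambda>_. UNIV))"
  proof
    fix M :: "bit mat" assume M: "M \<in> carrier_mat s s"
    have "M = mat s s (restrict (\<lambda>p. M $$ p) ?D)"
      using M by (intro eq_matI) auto
    moreover have "restrict (\<lambda>p. M $$ p) ?D \<in> PiE ?D (\<lambda>_. UNIV)" by auto
    ultimately show "M \<in> (\<lambda>f. mat s s f) ` (PiE ?D (\<lambda>_. UNIV))" by blast
  qed
  moreover have "finite (PiE ?D (\<lambda>_. UNIV :: bit set))"
    by (intro finite_PiE) (auto simp: *)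
  ultimately have "finite (carrier_mat s s :: bit mat set)"
    using finite_surj by blast
  then show ?thesis unfolding inv_mats_def by simp
qed

lemma inv_mats_nonempty: "inv_mats s \<noteq> {}"
proof -
  have "1\<^sub>m s \<in> inv_mats s"
    unfolding inv_mats_def invertible_mat_def inverts_mat_def
    by (auto intro!: exI[of _ "1\<^sub>m s"])
  then show ?thesis by blast
qed

end

theory Submission
  imports Defs "Jordan_Normal_Form.Determinant" "HOL-Library.FuncSet" "HOL-Real_Asymp.Real_Asymp"
begin

text \<open>
  In a random matrix with independent entries equal to 1 with probability \<open>p\<close>, each 2 by 2
  submatrix is invertible with probability \<open>2p\<^sup>2(1 - p\<^sup>2)\<close>, which is \<open>40/81\<close> for \<open>p = 2/3\<close>, so some
  matrix attains at least this average. Any square matrix over a field becomes invertible after a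
  suitable change of its diagonal. This change does not touch the submatrices whose row and
  column index sets are disjoint, and asymptotically these are all of them.
\<close>

section \<open>Determinants and nonsingular diagonal changes\<close>

lemma invertible_mat_if_det_nonzero:
  fixes A :: "'a :: field mat"
  assumes A: "A \<in> carrier_mat n n" and det: "det A \<noteq> 0"
  shows "invertible_mat A"
proof -
  let ?B = "inverse (det A) \<cdot>\<^sub>m adj_mat A"
  have adj: "adj_mat A \<in> carrier_mat n n" using adj_mat[OF A] by simp
  have "A * ?B = 1\<^sub>m n"
    using mult_smult_distrib[OF A adj] adj_mat(2)[OF A] det by auto
  moreover have "?B * A = 1\<^sub>m n"
    using mult_smult_assoc_mat[OF adj A] adj_mat(3)[OF A] det by auto
  ultimately show ?thesis
    using A adj unfolding invertible_mat_def inverts_mat_def by (auto intro!: exI[of _ ?B])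
qed

lemma det_2:
  fixes A :: "'a :: comm_ring_1 mat"
  assumes A: "A \<in> carrier_mat 2 2"
  shows "det A = A $$ (0,0) * A $$ (1,1) - A $$ (0,1) * A $$ (1,0)"
proof -
  have "det A = (\<Sum>j<2. A $$ (0,j) * cofactor A 0 j)"
    using laplace_expansion_row[OF A, of 0] by simp
  then show ?thesis
    using A by (simp add: numeral_2_eq_2 cofactor_def mat_delete_def det_single)
qed

text \<open>The diagonal entries are chosen one after another. Once the leading block is
  nonsingular, the next diagonal entry cannot fail at both 0 and 1, so two candidate values suffice
  and the argument covers the field of two elements.\<close>

lemma exists_diagonal_det_nonzero:
  fixes M :: "'a :: idom mat"
  assumes "M \<in> carrier_mat n n"
  shows "\<exists>A \<in> carrier_mat n n. det A \<noteq> 0 \<and> (\<forall>i<n. \<forall>j<n. i \<noteq> j \<longrightarrow> A $$ (i,j) = M $$ (i,j))"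
  using assms
proof (induction n arbitrary: M)
  case 0
  then show ?case by (auto intro!: bexI[of _ M])
next
  case (Suc n)
  obtain A where A: "A \<in> carrier_mat n n" "det A \<noteq> 0"
    and off: "\<And>i j. i < n \<Longrightarrow> j < n \<Longrightarrow> i \<noteq> j \<Longrightarrow> A $$ (i,j) = M $$ (i,j)"
    using Suc.IH[of "mat n n (\<lambda>p. M $$ p)"] by auto
  define B where "B d = mat (Suc n) (Suc n)
    (\<lambda>(i,j). if i < n \<and> j < n then A $$ (i,j) else if i = n \<and> j = n then d else M $$ (i,j))" for d
  have B: "B d \<in> carrier_mat (Suc n) (Suc n)" for d by (simp add: B_def)
  have minor: "mat_delete (B d) n n = A" for d
    using A(1) by (auto simp: B_def mat_delete_def)
  \<comment> \<open>These cofactors delete row \<open>n\<close>, which holds the only entry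
    depending on \<open>d\<close>.\<close>
  have cof: "cofactor (B d) n j = cofactor (B 0) n j" if "j < n" for d j
    unfolding cofactor_def using that
    by (intro arg_cong[of _ _ "\<lambda>X. _ * det X"]) (auto simp: B_def mat_delete_def)
  \<comment> \<open>The determinant is affine in the last diagonal entry, with slope the leading principal minor.\<close>
  have "det (B d) = (\<Sum>j<n. M $$ (n,j) * cofactor (B 0) n j) + d * det A" for d
  proof -
    have "B d $$ (n,j) = M $$ (n,j)" if "j < n" for j using that by (simp add: B_def)
    then have "(\<Sum>j<n. B d $$ (n,j) * cofactor (B d) n j) = (\<Sum>j<n. M $$ (n,j) * cofactor (B 0) n j)"
      by (intro sum.cong arg_cong2[of _ _ _ _ times] cof[of _ d]) simp_all
    moreover have "B d $$ (n,n) = d" by (simp add: B_def)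
    moreover have "cofactor (B d) n n = det A" by (simp add: cofactor_def minor)
    ultimately show ?thesis
      using laplace_expansion_row[OF B, of n d] by simp
  qed
  \<comment> \<open>The two determinants differ by the nonzero \<open>det A\<close>, so they cannot
    both vanish.\<close>
  then have "det (B 1) = det (B 0) + det A" by simp
  then have "\<exists>d. det (B d) \<noteq> 0" using A(2) by (metis add_0)
  then obtain d where "det (B d) \<noteq> 0" ..
  moreover have "B d $$ (i,j) = M $$ (i,j)" if "i < Suc n" "j < Suc n" "i \<noteq> j" for i j
    using that off by (auto simp: B_def)
  ultimately show ?case using B by blast
qed

section \<open>Product Bernoulli weights\<close>

text \<open>Independence in finite form: the sum of products factors over the coordinates, where
  those outside \<open>T\<close> contribute \<open>p + (1 - p) = 1\<close> and those in
  \<open>T\<close> contribute \<open>p\<close>. The case of empty \<open>T\<close> gives total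
  weight 1.\<close>

lemma sum_bernoulli_weights:
  fixes p :: real
  assumes "finite D" "T \<subseteq> D"
  shows "(\<Sum>f \<in> PiE D (\<lambda>_. UNIV). (\<Prod>d\<in>D. if f d then p else 1 - p) * (\<Prod>d\<in>T. of_bool (f d)))
    = p ^ card T"
proof -
  \<comment> \<open>Padding the product over \<open>T\<close> with ones lets both products merge
    into one over \<open>D\<close>.\<close>
  have "(\<Prod>d\<in>D. if f d then p else 1 - p) * (\<Prod>d\<in>T. of_bool (f d))
      = (\<Prod>d\<in>D. (if f d then p else 1 - p) * (if d \<in> T then of_bool (f d) else 1))" for f
  proof -
    have "(\<Prod>d\<in>D. if d \<in> T then of_bool (f d) else 1) = (\<Prod>d\<in>T. of_bool (f d) :: real)"
      using prod.inter_restrict[OF assms(1), of "\<lambda>d. of_bool (f d) :: real" T] assms(2)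
      by (simp add: Int_absorb1)
    then show ?thesis by (simp add: prod.distrib)
  qed
  then have "(\<Sum>f \<in> PiE D (\<lambda>_. UNIV). (\<Prod>d\<in>D. if f d then p else 1 - p) * (\<Prod>d\<in>T. of_bool (f d)))
      = (\<Sum>f \<in> PiE D (\<lambda>_. UNIV). \<Prod>d\<in>D. (if f d then p else 1 - p) * (if d \<in> T then of_bool (f d) else 1))"
    by simp
  also have "\<dots> = (\<Prod>d\<in>D. \<Sum>b\<in>UNIV. (if b then p else 1 - p) * (if d \<in> T then of_bool b else 1))"
    using assms(1) by (subst prod_sum_PiE) auto
  also have "\<dots> = (\<Prod>d\<in>D. if d \<in> T then p else 1)"
    by (intro prod.cong) (auto simp: UNIV_bool)
  also have "\<dots> = p ^ card T"
    using prod.inter_restrict[OF assms(1), of "\<lambda>_. p" T] assms(2) by (simp add: Int_absorb1)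
  finally show ?thesis .
qed

section \<open>Minors away from the diagonal\<close>

text \<open>Disjointness of \<open>I\<close> and \<open>J\<close> says that the block of positions
  \<open>I \<times> J\<close> avoids the diagonal.\<close>

definition disjoint_pairs :: "nat \<Rightarrow> (nat set \<times> nat set) set" where
  "disjoint_pairs s = {(I, J). I \<subseteq> {..<s} \<and> card I = 2 \<and> J \<subseteq> {..<s} \<and> card J = 2 \<and> I \<inter> J = {}}"

lemma disjoint_pairs_Sigma:
  "disjoint_pairs s = (SIGMA I : {I. I \<subseteq> {..<s} \<and> card I = 2}. {J. J \<subseteq> {..<s} - I \<and> card J = 2})"
  unfolding disjoint_pairs_def by auto

lemma finite_disjoint_pairs: "finite (disjoint_pairs s)"
  unfolding disjoint_pairs_Sigma by (intro finite_SigmaI) auto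

text \<open>Choosing \<open>I\<close> first leaves \<open>s - 2\<close> indices for
  \<open>J\<close>. Truncation of \<open>s - 2\<close> for \<open>s < 2\<close> is harmless, as
  \<open>s choose 2\<close> is then zero.\<close>

lemma card_disjoint_pairs: "card (disjoint_pairs s) = (s choose 2) * ((s - 2) choose 2)"
proof -
  have "card {J. J \<subseteq> {..<s} - I \<and> card J = 2} = (s - 2) choose 2" if "I \<subseteq> {..<s}" "card I = 2" for I
    using that n_subsets[of "{..<s} - I" 2] by (simp add: card_Diff_subset finite_subset)
  then have "card (disjoint_pairs s)
      = (\<Sum>I\<in>{I. I \<subseteq> {..<s} \<and> card I = 2}. (s - 2) choose 2)"
    unfolding disjoint_pairs_Sigma by (subst card_SigmaI) auto
  also have "\<dots> = (s choose 2) * ((s - 2) choose 2)"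
    using n_subsets[of "{..<s}" 2] by simp
  finally show ?thesis .
qed

lemma pick_two:
  assumes "card I = 2"
  shows "pick I 0 \<in> I" "pick I 1 \<in> I" "pick I 0 \<noteq> pick I 1"
  using pick_in_set_le[of 0 I] pick_in_set_le[of 1 I] pick_mono_le[of 1 I 0] assms by auto

lemma det_submatrix_2:
  fixes A :: "'a :: comm_ring_1 mat"
  assumes A: "A \<in> carrier_mat m n"
    and I: "I \<subseteq> {..<m}" "card I = 2" and J: "J \<subseteq> {..<n}" "card J = 2"
  shows "submatrix A I J \<in> carrier_mat 2 2"
    and "det (submatrix A I J) = A $$ (pick I 0, pick J 0) * A $$ (pick I 1, pick J 1)
      - A $$ (pick I 0, pick J 1) * A $$ (pick I 1, pick J 0)"
proof -
  \<comment> \<open>\<open>submatrix\<close> cuts its index sets down to the range of the matrix;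
    here the cut changes nothing.\<close>
  have [simp]: "{i. i < m \<and> i \<in> I} = I" "{j. j < n \<and> j \<in> J} = J" using I J by auto
  show S: "submatrix A I J \<in> carrier_mat 2 2"
    using A I J by (intro carrier_matI) (simp_all add: dim_submatrix)
  show "det (submatrix A I J) = A $$ (pick I 0, pick J 0) * A $$ (pick I 1, pick J 1)
      - A $$ (pick I 0, pick J 1) * A $$ (pick I 1, pick J 0)"
    using A I J by (simp add: det_2[OF S] submatrix_index)
qed

text \<open>The indicator of \<open>ad \<noteq> bc\<close> is the polynomial \<open>ad + bc - 2abcd\<close>.\<close>

lemma sum_bernoulli_weights_det:
  fixes p :: real
  assumes "finite D" and "I \<times> J \<subseteq> D" and I: "i \<in> I" "i' \<in> I" "i \<noteq> i'" and J: "j \<in> J" "j' \<in> J" "j \<noteq> j'"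
  shows "(\<Sum>f \<in> PiE D (\<lambda>_. UNIV). (\<Prod>d\<in>D. if f d then p else 1 - p)
      * of_bool ((f (i,j) \<and> f (i',j')) \<noteq> (f (i,j') \<and> f (i',j)))) = 2 * p\<^sup>2 * (1 - p\<^sup>2)"
proof -
  let ?w = "\<lambda>f. \<Prod>d\<in>D. if f d then p else 1 - p"
  \<comment> \<open>The two diagonals of the block are disjoint as \<open>i \<noteq> i'\<close> and
    \<open>j \<noteq> j'\<close>, so the exponents of \<open>p\<close> are 2, 2 and 4.\<close>
  let ?T1 = "{(i,j),(i',j')}" and ?T2 = "{(i,j'),(i',j)}"
  have E: "(\<Sum>f \<in> PiE D (\<lambda>_. UNIV). ?w f * (\<Prod>d\<in>T. of_bool (f d))) = p ^ card T"
    if "T \<subseteq> I \<times> J" for T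
    using sum_bernoulli_weights[OF assms(1)] that assms(2) by blast
  have "of_bool ((f (i,j) \<and> f (i',j')) \<noteq> (f (i,j') \<and> f (i',j)))
      = (\<Prod>d\<in>?T1. of_bool (f d)) + (\<Prod>d\<in>?T2. of_bool (f d))
        - 2 * (\<Prod>d\<in>?T1 \<union> ?T2. of_bool (f d) :: real)" for f
    using I J by (auto simp: of_bool_def)
  then have "(\<Sum>f \<in> PiE D (\<lambda>_. UNIV). ?w f * of_bool ((f (i,j) \<and> f (i',j')) \<noteq> (f (i,j') \<and> f (i',j))))
      = p ^ card ?T1 + p ^ card ?T2 - 2 * p ^ card (?T1 \<union> ?T2)"
    using I J E[of ?T1] E[of ?T2] E[of "?T1 \<union> ?T2"]
    by (simp only: right_diff_distrib distrib_left sum.distrib sum_subtractf mult.left_commute[of _ 2]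
        flip: sum_distrib_left) simp
  also have "\<dots> = 2 * p\<^sup>2 * (1 - p\<^sup>2)"
    using I J by (simp add: power2_eq_square power4_eq_xxxx algebra_simps card_insert_if)
  finally show ?thesis .
qed

text \<open>First moment method: the left side is the weighted average of the count on the right,
  and the bounds on \<open>p\<close> make the weights nonnegative.\<close>

lemma exists_many_disjoint_minors:
  fixes p :: real
  assumes p: "0 \<le> p" "p \<le> 1"
  shows "\<exists>M \<in> carrier_mat s s. 2 * p\<^sup>2 * (1 - p\<^sup>2) * card (disjoint_pairs s)
    \<le> card {(I, J) \<in> disjoint_pairs s. det (submatrix (M :: bit mat) I J) \<noteq> 0}"
proof -
  define D where "D = {..<s} \<times> {..<s}"
  define w where "w f = (\<Prod>d\<in>D. if f d then p else 1 - p)" for f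
  define M :: "(nat \<times> nat \<Rightarrow> bool) \<Rightarrow> bit mat" where "M f = mat s s (\<lambda>d. of_bool (f d))" for f
  define X where "X f = real (card {(I, J) \<in> disjoint_pairs s. det (submatrix (M f) I J) \<noteq> 0})" for f
  let ?F = "PiE D (\<lambda>_. UNIV :: bool set)" and ?c = "2 * p\<^sup>2 * (1 - p\<^sup>2)"
  have D: "finite D" by (simp add: D_def)
  have M: "M f \<in> carrier_mat s s" for f by (simp add: M_def)
  have w_nonneg: "w f \<ge> 0" for f using p by (auto simp: w_def intro!: prod_nonneg)
  have w_sum: "sum w ?F = 1"
    using sum_bernoulli_weights[OF D, of "{}" p] by (simp add: w_def)
  have X: "X f = (\<Sum>(I, J) \<in> disjoint_pairs s. of_bool (det (submatrix (M f) I J) \<noteq> 0))" for f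
    using finite_disjoint_pairs[of s]
    by (simp add: X_def case_prod_unfold of_bool_def sum.If_cases Int_def)
  have "(\<Sum>f\<in>?F. w f * of_bool (det (submatrix (M f) I J) \<noteq> 0)) = ?c"
    if "(I, J) \<in> disjoint_pairs s" for I J
  proof -
    have I: "I \<subseteq> {..<s}" "card I = 2" and J: "J \<subseteq> {..<s}" "card J = 2"
      using that by (auto simp: disjoint_pairs_def)
    note pI = pick_two[OF I(2)] and pJ = pick_two[OF J(2)]
    have "pick I 0 < s" "pick I 1 < s" "pick J 0 < s" "pick J 1 < s" using pI pJ I J by auto
    \<comment> \<open>Over \<open>bit\<close> a difference is nonzero exactly when its two terms
      differ, and products are conjunctions.\<close>
    then have "det (submatrix (M f) I J) \<noteq> 0 \<longleftrightarrow>
        (f (pick I 0, pick J 0) \<and> f (pick I 1, pick J 1)) \<noteq> (f (pick I 0, pick J 1) \<and> f (pick I 1, pick J 0))" for f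
      by (subst det_submatrix_2[OF M I J]) (auto simp: M_def)
    moreover have "I \<times> J \<subseteq> D" using I J by (auto simp: D_def)
    ultimately show ?thesis
      using sum_bernoulli_weights_det[OF D _ pI pJ, of p] by (simp add: w_def)
  qed
  then have "(\<Sum>(I, J) \<in> disjoint_pairs s. \<Sum>f\<in>?F. w f * of_bool (det (submatrix (M f) I J) \<noteq> 0))
      = (\<Sum>(I, J) \<in> disjoint_pairs s. ?c)"
    by (intro sum.cong) auto
  \<comment> \<open>Linearity of expectation.\<close>
  moreover have "(\<Sum>f\<in>?F. w f * X f)
      = (\<Sum>(I, J) \<in> disjoint_pairs s. \<Sum>f\<in>?F. w f * of_bool (det (submatrix (M f) I J) \<noteq> 0))"
    unfolding X case_prod_unfold sum_distrib_left by (rule sum.swap)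
  ultimately have avg: "(\<Sum>f\<in>?F. w f * X f) = ?c * card (disjoint_pairs s)"
    by simp
  have "\<exists>f. ?c * card (disjoint_pairs s) \<le> X f"
  proof (rule ccontr)
    assume "\<not> (\<exists>f. ?c * card (disjoint_pairs s) \<le> X f)"
    then have less: "X f < ?c * card (disjoint_pairs s)" for f by (simp add: not_le)
    \<comment> \<open>Weights may vanish when \<open>p\<close> is 0 or 1, so strictness comes from
      one array of positive weight, which exists because the total is 1.\<close>
    obtain g where g: "g \<in> ?F" "w g > 0"
      using w_sum w_nonneg by (metis less_eq_real_def sum.neutral zero_neq_one)
    have "(\<Sum>f\<in>?F. w f * X f) < (\<Sum>f\<in>?F. w f * (?c * card (disjoint_pairs s)))"
    proof (rule sum_strict_mono_ex1)
      show "\<forall>f\<in>?F. w f * X f \<le> w f * (?c * card (disjoint_pairs s))"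
        using less w_nonneg by (meson less_imp_le mult_left_mono)
      show "\<exists>f\<in>?F. w f * X f < w f * (?c * card (disjoint_pairs s))"
        using g less by (meson mult_strict_left_mono)
    qed (use D in \<open>auto simp: finite_PiE\<close>)
    then show False using avg w_sum by (simp flip: sum_distrib_right)
  qed
  then show ?thesis using M unfolding X_def by blast
qed

section \<open>From minors to bounds on \<open>R2\<close>\<close>

text \<open>Keeping only disjoint pairs can only lower the count \<open>N2 A\<close>, and
  \<open>A\<close> itself competes in the maximum.\<close>

lemma R2_ge:
  fixes A :: "bit mat"
  assumes A: "A \<in> carrier_mat s s" "det A \<noteq> 0"
  shows "real (card {(I, J) \<in> disjoint_pairs s. det (submatrix A I J) \<noteq> 0})
    / (real (s choose 2))\<^sup>2 \<le> R2 s" (is "real ?k / _ \<le> _")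
proof -
  let ?S = "{(I, J). I \<subseteq> {..<s} \<and> card I = 2 \<and> J \<subseteq> {..<s} \<and> card J = 2 \<and> invertible_mat (submatrix A I J)}"
  have "finite ?S"
    by (rule finite_subset[of _ "Pow {..<s} \<times> Pow {..<s}"]) auto
  moreover have "{(I, J) \<in> disjoint_pairs s. det (submatrix A I J) \<noteq> 0} \<subseteq> ?S"
    by (auto simp: disjoint_pairs_def simp del: bit_not_zero_iff
        intro!: invertible_mat_if_det_nonzero[OF det_submatrix_2(1)[OF A(1)]])
  ultimately have "?k \<le> card ?S" by (rule card_mono)
  then have "?k \<le> N2 A" using A(1) by (simp add: N2_def)
  then have "real ?k / (real (s choose 2))\<^sup>2 \<le> R2_mat A"
    using A(1) by (auto simp: R2_mat_def intro!: divide_right_mono)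
  also have "R2_mat A \<le> R2 s"
    unfolding R2_def using A(1) invertible_mat_if_det_nonzero[OF A]
    by (intro Max_ge finite_imageI finite_inv_mats) (simp add: inv_mats_def)
  finally show ?thesis .
qed

text \<open>The matrix with many invertible minors may be singular; repairing its diagonal leaves
  the counted minors intact. The quotient of binomials is the share of disjoint pairs among all
  pairs.\<close>

lemma R2_lower_bound:
  fixes p :: real
  assumes p: "0 \<le> p" "p \<le> 1"
  shows "2 * p\<^sup>2 * (1 - p\<^sup>2) * (real ((s - 2) choose 2) / real (s choose 2)) \<le> R2 s"
proof -
  obtain M :: "bit mat" where M: "M \<in> carrier_mat s s" and
    many: "2 * p\<^sup>2 * (1 - p\<^sup>2) * card (disjoint_pairs s)
      \<le> card {(I, J) \<in> disjoint_pairs s. det (submatrix M I J) \<noteq> 0}"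
    using exists_many_disjoint_minors[OF p] by blast
  obtain A where A: "A \<in> carrier_mat s s" "det A \<noteq> 0"
    and off: "\<And>i j. i < s \<Longrightarrow> j < s \<Longrightarrow> i \<noteq> j \<Longrightarrow> A $$ (i,j) = M $$ (i,j)"
    using exists_diagonal_det_nonzero[OF M] by blast
  have "det (submatrix A I J) = det (submatrix M I J)" if "(I, J) \<in> disjoint_pairs s" for I J
  proof -
    have IJ: "I \<subseteq> {..<s}" "card I = 2" "J \<subseteq> {..<s}" "card J = 2" and "I \<inter> J = {}"
      using that by (auto simp: disjoint_pairs_def)
    then have "A $$ (i,j) = M $$ (i,j)" if "i \<in> I" "j \<in> J" for i j
      using that by (intro off) auto
    then show ?thesis
      unfolding det_submatrix_2(2)[OF A(1) IJ] det_submatrix_2(2)[OF M IJ]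
      using pick_two[OF IJ(2)] pick_two[OF IJ(4)] by metis
  qed
  then have eq: "{(I, J) \<in> disjoint_pairs s. det (submatrix A I J) \<noteq> 0}
      = {(I, J) \<in> disjoint_pairs s. det (submatrix M I J) \<noteq> 0}" (is "?S = ?S'")
    by auto
  \<comment> \<open>One factor \<open>s choose 2\<close> cancels; if it is zero, both sides are zero
    because division by zero yields zero.\<close>
  have "2 * p\<^sup>2 * (1 - p\<^sup>2) * (real ((s - 2) choose 2) / real (s choose 2))
      = 2 * p\<^sup>2 * (1 - p\<^sup>2) * card (disjoint_pairs s) / (real (s choose 2))\<^sup>2"
    by (simp add: card_disjoint_pairs power2_eq_square)
  also have "\<dots> \<le> card ?S / (real (s choose 2))\<^sup>2"
    using many unfolding eq by (intro divide_right_mono) auto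
  also have "\<dots> \<le> R2 s" by (rule R2_ge[OF A])
  finally show ?thesis .
qed

section \<open>Passage to the limit\<close>

lemma real_choose_two: "real (n choose 2) = real n * (real n - 1) / 2"
  by (induction n) (auto simp: numeral_2_eq_2 field_simps)

lemma choose_two_ratio_tendsto:
  "(\<lambda>s. real ((s - 2) choose 2) / real (s choose 2)) \<longlonglongrightarrow> 1"
proof (rule Lim_transform_eventually)
  show "(\<lambda>s. ((real s - 2) * (real s - 3)) / (real s * (real s - 1))) \<longlonglongrightarrow> 1"
    by real_asymp
  show "\<forall>\<^sub>F s in sequentially. ((real s - 2) * (real s - 3)) / (real s * (real s - 1))
      = real ((s - 2) choose 2) / real (s choose 2)"
    \<comment> \<open>From \<open>s = 2\<close> on, the truncated \<open>s - 2\<close> agrees with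
      real subtraction.\<close>
    using eventually_ge_at_top[of 2]
    by eventually_elim (simp add: real_choose_two of_nat_diff)
qed

theorem corollary5p5:
  shows "limsup (\<lambda>s. ereal (R2 s)) \<ge> ereal (40 / 81)"
proof -
  let ?g = "\<lambda>s. 40 / 81 * (real ((s - 2) choose 2) / real (s choose 2))"
  \<comment> \<open>With \<open>p = 2/3\<close> the constant is 2 * 4/9 * 5/9 = 40/81.\<close>
  have "?g s \<le> R2 s" for s
    using R2_lower_bound[of "2/3" s] by (simp add: power2_eq_square)
  moreover have "(\<lambda>s. ereal (?g s)) \<longlonglongrightarrow> ereal (40 / 81)"
    using tendsto_mult_left[OF choose_two_ratio_tendsto, of "40 / 81"] by simp
  then have "limsup (\<lambda>s. ereal (?g s)) = ereal (40 / 81)"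
    by (intro lim_imp_Limsup) auto
  ultimately show ?thesis
    by (metis (mono_tags, lifting) Limsup_mono always_eventually ereal_less_eq(3))
qed

end
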